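(* Let $G$ be a $k$-terminal network with terminals $T$, and let $G'$ be a cut-sparsifier for $G$ of quality $\beta\ge1$. Then for every demand-support $H=(T,F)$ and every nonzero $\mathbf d\in\mathbb R_+^{F}$, $$\frac{1}{\gamma(G',H)}\le\frac{\lambda_{G'}(\mathbf d)}{\lambda_G(\mathbf d)}\le\beta\cdot\gamma(G,H).$$ Therefore, the network $G'$ with all edge capacities multiplied by $\gamma(G',H)$ is a flow sparsifier for $G$ of quality $\beta\gamma(G,H)\gamma(G',H)$ for all demands supported on $H$. Moreover, if $G'$ is a contraction-based cut-sparsifier, then $\lambda_G(\mathbf d)\le\lambda_{G'}(\mathbf d)$, and $G'$ itself is a flow sparsifier for $G$ of quality $\beta\gamma(G,H)$ for demands supported on $H$.
   Context: A $k$-terminal network $G=(V,E,c)$ is a finite connected undirected graph with nonnegative capacities and terminal set $T\subseteq V$, $|T|=k$. A demand-support is a graph $H=(T,F)$ on the terminals; a demand supported on $H$ is $\mathbf d\in\mathbb R_+^F$, which can be routed in $G$ if a multicommodity flow simultaneously sends $d_{ij}$ units between $i,j$ for each $\{i,j\}\in F$ with total flow on each edge at most its capacity; $\mathcal D(G,H)$ is the set of such routable vectors and $\lambda_G(\mathbf d)=\sup\{\lambda\ge0:\lambda\mathbf d\in\mathcal D(G,H)\}$. The sparsity of $S\subseteq V$ is $\Phi_G(S;\mathbf d)=\sum_{e\in\partial S}c_e/\sum_{\{i,j\}:|\{i,j\}\cap S|=1}d_{ij}$, and $\Phi_G(\mathbf d)=\min_{S\subseteq V}\Phi_G(S;\mathbf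 d)$. The flow-cut gap is $\gamma(G,H)=\max\{\Phi_G(\mathbf d)/\lambda_G(\mathbf d):\mathbf d\in\mathcal D(G,H)\setminus\{0\}\}$. For a partition $(A,B)$ of $T$, $\mathrm{mincut}_G(A,B)$ is the minimum capacity of an edge set separating $A$ from $B$. A cut-sparsifier of $G$ of quality $\beta\ge1$ is a network $G'=(V',E',c')$ with $T\subseteq V'$ such that $\mathrm{mincut}_G(A,B)\le\mathrm{mincut}_{G'}(A,B)\le\beta\,\mathrm{mincut}_G(A,B)$ for every partition $(A,B)$ of $T$; it is contraction-based if it is obtained from $G$ by increasing capacities of some edges and identifying some vertices. A network $G''\supseteq T$ is a flow sparsifier of $G$ of quality $q$ for demands supported on $H$ if $\lambda_G(\mathbf d)\le\lambda_{G''}(\mathbf d)\le q\lambda_G(\mathbf d)$ for all nonzero $\mathbf d\in\mathbb R_+^F$. *)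

theory Defs
  imports Complex_Main
begin

text \<open>Graphs are simple: an edge is a two-element vertex set, and \<open>cap\<close> is only relevant on edges.\<close>

record 'v network =
  verts :: "'v set"
  edges :: "'v set set"
  cap :: "'v set \<Rightarrow> real"

definition path_edges :: "'v list \<Rightarrow> 'v set set" where
  "path_edges p = {{p ! i, p ! Suc i} | i. Suc i < length p}"

definition paths :: "'v network \<Rightarrow> 'v list set" where
  "paths G = {p. p \<noteq> [] \<and> distinct p \<and> set p \<subseteq> verts G \<and> path_edges p \<subseteq> edges G}"

definition is_network :: "'v network \<Rightarrow> bool" where
  "is_network G \<longleftrightarrow>
     finite (verts G) \<and>
     edges G \<subseteq> {{u, v} | u v. u \<in> verts G \<and> v \<in> verts G \<and> u \<noteq> v} \<and>
     (\<forall>e\<in>edges G. 0 \<le> cap G e) \<and>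
     (\<forall>u\<in>verts G. \<forall>v\<in>verts G. \<exists>p\<in>paths G. hd p = u \<and> last p = v)"

definition terminal_network :: "nat \<Rightarrow> 'v set \<Rightarrow> 'v network \<Rightarrow> bool" where
  "terminal_network k T G \<longleftrightarrow> is_network G \<and> T \<subseteq> verts G \<and> card T = k"


text \<open>A demand-support \<open>(T, F)\<close> is represented by its edge set \<open>F\<close>; a vector in \<open>\<real>\<^sub>+\<^sup>F\<close> is a
  nonnegative function on vertex pairs vanishing outside \<open>F\<close>, so the zero vector is \<open>\<lambda>_. 0\<close>.\<close>

definition demand_support :: "'v set \<Rightarrow> 'v set set \<Rightarrow> bool" where
  "demand_support T F \<longleftrightarrow> F \<subseteq> {{i, j} | i j. i \<in> T \<and> j \<in> T \<and> i \<noteq> j}"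

definition demands :: "'v set set \<Rightarrow> ('v set \<Rightarrow> real) set" where
  "demands F = {d. (\<forall>e\<in>F. 0 \<le> d e) \<and> (\<forall>e. e \<notin> F \<longrightarrow> d e = 0)}"

text \<open>A multicommodity flow is a path flow \<open>x\<close>. The two end vertices of a path determine the
  commodity it serves, and a path and its reverse serve the same one. Paths are simple, so each
  uses an edge at most once.\<close>

definition routes :: "'v network \<Rightarrow> 'v set set \<Rightarrow> ('v list \<Rightarrow> real) \<Rightarrow> ('v set \<Rightarrow> real) \<Rightarrow> bool" where
  "routes G F x d \<longleftrightarrow>
     (\<forall>p\<in>paths G. 0 \<le> x p) \<and>
     (\<forall>f\<in>F. (\<Sum>p | p \<in> paths G \<and> {hd p, last p} = f. x p) = d f) \<and>
     (\<forall>e\<in>edges G. (\<Sum>p | p \<in> paths G \<and> {hd p, last p} \<in> F \<and> e \<in> path_edges p. x p) \<le> cap G e)"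

definition routable :: "'v network \<Rightarrow> 'v set set \<Rightarrow> ('v set \<Rightarrow> real) set" where
  "routable G F = {d \<in> demands F. \<exists>x. routes G F x d}"

definition flow_rate :: "'v network \<Rightarrow> 'v set set \<Rightarrow> ('v set \<Rightarrow> real) \<Rightarrow> real" where
  "flow_rate G F d = Sup {l. 0 \<le> l \<and> (\<lambda>e. l * d e) \<in> routable G F}"

definition boundary :: "'v network \<Rightarrow> 'v set \<Rightarrow> 'v set set" where
  "boundary G S = {e \<in> edges G. card (e \<inter> S) = 1}"

definition separated_demand :: "'v set set \<Rightarrow> ('v set \<Rightarrow> real) \<Rightarrow> 'v set \<Rightarrow> real" where
  "separated_demand F d S = (\<Sum>f | f \<in> F \<and> card (f \<inter> S) = 1. d f)"

definition cut_sparsity :: "'v network \<Rightarrow> 'v set set \<Rightarrow> 'v set \<Rightarrow> ('v set \<Rightarrow> real) \<Rightarrow> real" where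
  "cut_sparsity G F S d = (\<Sum>e\<in>boundary G S. cap G e) / separated_demand F d S"

text \<open>Sets \<open>S\<close> separating no demand have sparsity \<open>\<infinity>\<close> (or the undefined \<open>0/0\<close>) and do not take
  part in the minimum; division by \<open>0\<close> in HOL would give \<open>0\<close>.\<close>

definition sparsity :: "'v network \<Rightarrow> 'v set set \<Rightarrow> ('v set \<Rightarrow> real) \<Rightarrow> real" where
  "sparsity G F d =
     Min {cut_sparsity G F S d | S. S \<subseteq> verts G \<and> separated_demand F d S \<noteq> 0}"

text \<open>The supremum is a maximum: the ratio is invariant under scaling \<open>d\<close> and continuous on the
  compact simplex of normalized demands whose pairs are joined by paths of positive capacity.
  When no nonzero demand is routable (for instance \<open>F = {}\<close>) the maximum ranges over the empty
  set, and the gap is \<open>1\<close> by convention, the least possible value of a ratio.\<close>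

definition flow_cut_gap :: "'v network \<Rightarrow> 'v set set \<Rightarrow> real" where
  "flow_cut_gap G F =
     (if routable G F - {\<lambda>_. 0} = {} then 1
      else Sup {sparsity G F d / flow_rate G F d | d. d \<in> routable G F - {\<lambda>_. 0}})"


definition separates :: "'v network \<Rightarrow> 'v set set \<Rightarrow> 'v set \<Rightarrow> 'v set \<Rightarrow> bool" where
  "separates G C A B \<longleftrightarrow>
     (\<forall>p\<in>paths G. hd p \<in> A \<and> last p \<in> B \<longrightarrow> path_edges p \<inter> C \<noteq> {})"

definition mincut :: "'v network \<Rightarrow> 'v set \<Rightarrow> 'v set \<Rightarrow> real" where
  "mincut G A B = Min {(\<Sum>e\<in>C. cap G e) | C. C \<subseteq> edges G \<and> separates G C A B}"

definition cut_sparsifier :: "'v set \<Rightarrow> 'v network \<Rightarrow> 'v network \<Rightarrow> real \<Rightarrow> bool" where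
  "cut_sparsifier T G G' \<beta> \<longleftrightarrow>
     1 \<le> \<beta> \<and> is_network G' \<and> T \<subseteq> verts G' \<and>
     (\<forall>A B. A \<union> B = T \<and> A \<inter> B = {} \<and> A \<noteq> {} \<and> B \<noteq> {} \<longrightarrow>
        mincut G A B \<le> mincut G' A B \<and> mincut G' A B \<le> \<beta> * mincut G A B)"

text \<open>Here \<open>c\<close> is the increased capacity function and \<open>\<phi>\<close> maps each vertex of \<open>G\<close> to the vertex of
  \<open>G'\<close> it is identified into; terminals keep their names, so distinct terminals are never
  identified. Edges that become loops disappear, and edges that become parallel are merged,
  adding up their capacities.\<close>

definition contraction_based :: "'v set \<Rightarrow> 'v network \<Rightarrow> 'v network \<Rightarrow> bool" where
  "contraction_based T G G' \<longleftrightarrow>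
     (\<exists>c \<phi>. (\<forall>e\<in>edges G. cap G e \<le> c e) \<and>
        (\<forall>t\<in>T. \<phi> t = t) \<and>
        verts G' = \<phi> ` verts G \<and>
        edges G' = {\<phi> ` e | e. e \<in> edges G \<and> card (\<phi> ` e) = 2} \<and>
        (\<forall>e'\<in>edges G'. cap G' e' = (\<Sum>e | e \<in> edges G \<and> \<phi> ` e = e'. c e)))"

definition scale_caps :: "real \<Rightarrow> 'v network \<Rightarrow> 'v network" where
  "scale_caps a G = G\<lparr>cap := (\<lambda>e. a * cap G e)\<rparr>"

definition flow_sparsifier ::
    "'v set \<Rightarrow> 'v set set \<Rightarrow> 'v network \<Rightarrow> 'v network \<Rightarrow> real \<Rightarrow> bool" where
  "flow_sparsifier T F G G' q \<longleftrightarrow>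
     is_network G' \<and> T \<subseteq> verts G' \<and>
     (\<forall>d \<in> demands F - {\<lambda>_. 0}.
        flow_rate G F d \<le> flow_rate G' F d \<and> flow_rate G' F d \<le> q * flow_rate G F d)"

end

theory Submission
  imports Defs
begin

text \<open>Every routing is bounded by every cut, so the flow rate is at most the sparsity. A minimum cut
  between \<open>A\<close> and \<open>T - A\<close> is the boundary of the set reachable from \<open>A\<close>, so preserving terminal
  min-cuts up to \<open>\<beta>\<close> preserves sparsities up to \<open>\<beta>\<close>. Chaining
  \<open>flow_rate \<le> sparsity \<le> gap * flow_rate\<close> in \<open>G\<close> and \<open>G'\<close> gives both bounds. The last inequality
  needs the gap to be the supremum of a bounded set: routing each demand along a single path of
  maximal bottleneck capacity loses at most a factor \<open>card (edges G) * card F\<close> against the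
  sparsity. Under a contraction, path flows are pushed forward along the contraction map.\<close>

section \<open>Paths and cuts\<close>

lemma path_edges_Nil [simp]: "path_edges [] = {}"
  and path_edges_single [simp]: "path_edges [v] = {}"
  by (auto simp: path_edges_def)

text \<open>The index-based definition becomes recursive on the list, so that the facts about paths
  below go by list induction.\<close>

lemma path_edges_Cons_Cons [simp]:
  "path_edges (u # v # p) = insert {u, v} (path_edges (v # p))"
proof -
  have "path_edges (u # v # p) =
      (\<lambda>i. {(u # v # p) ! i, (u # v # p) ! Suc i}) ` {i. Suc i < length (u # v # p)}"
    by (auto simp: path_edges_def)
  also have "{i. Suc i < length (u # v # p)} = insert 0 (Suc ` {i. Suc i < length (v # p)})"
    by (auto simp: image_iff) (metis less_Suc_eq_0_disj)
  finally show ?thesis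
    by (auto simp: path_edges_def image_image)
qed

lemma path_edges_Cons:
  "path_edges (v # p) = (if p = [] then {} else insert {v, hd p} (path_edges p))"
  by (cases p) auto

lemma path_edges_append_subset: "path_edges q \<subseteq> path_edges (p @ q)"
  by (induction p) (auto simp: path_edges_Cons)

lemma path_edges_snoc:
  "p \<noteq> [] \<Longrightarrow> path_edges (p @ [v]) = insert {last p, v} (path_edges p)"
  by (induction p) (auto simp: path_edges_Cons)

lemma path_edges_map: "path_edges (map f p) = (`) f ` path_edges p"
  by (induction p) (auto simp: path_edges_Cons hd_map)

lemma card_path_edge: "distinct p \<Longrightarrow> e \<in> path_edges p \<Longrightarrow> card e = 2"
proof (induction p)
  case (Cons v p)
  then show ?case
    by (cases p) (auto simp: path_edges_Cons)
qed simp

text \<open>Detours are cut out of a walk: when the new first vertex already lies on the simple path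
  found for the tail, the suffix starting there is kept. Since \<open>paths\<close> contains only
  lists without repetition, this is needed whenever a path is extended by an edge or mapped through
  a contraction.\<close>

lemma obtain_simple_path:
  assumes "w \<noteq> []"
  obtains p where "p \<noteq> []" "distinct p" "set p \<subseteq> set w" "hd p = hd w" "last p = last w"
    "path_edges p \<subseteq> path_edges w"
proof -
  have "\<exists>p. p \<noteq> [] \<and> distinct p \<and> set p \<subseteq> set w \<and> hd p = hd w \<and> last p = last w
      \<and> path_edges p \<subseteq> path_edges w"
    using assms
  proof (induction w)
    case (Cons v w)
    show ?case
    proof (cases "w = []")
      case True
      then show ?thesis by (intro exI[of _ "[v]"]) auto
    next
      case False
      with Cons.IH obtain p where p: "p \<noteq> []" "distinct p" "set p \<subseteq> set w" "hd p = hd w"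
        "last p = last w" "path_edges p \<subseteq> path_edges w" by blast
      show ?thesis
      proof (cases "v \<in> set p")
        case True
        then obtain xs ys where "p = xs @ v # ys" by (meson split_list)
        with p False path_edges_append_subset[of "v # ys" xs] show ?thesis
          by (intro exI[of _ "v # ys"]) (auto simp: path_edges_Cons[of v w])
      next
        case v: False
        with p False show ?thesis
          by (intro exI[of _ "v # p"]) (auto simp: path_edges_Cons)
      qed
    qed
  qed simp
  with that show thesis by blast
qed

lemma card_doubleton_Int_eq_1:
  "u \<noteq> v \<Longrightarrow> card ({u, v} \<inter> S) = 1 \<longleftrightarrow> (u \<in> S) \<noteq> (v \<in> S)"
  by (cases "u \<in> S"; cases "v \<in> S") auto

text \<open>Discrete intermediate value argument: membership in \<open>S\<close> differs at the two
  ends, so it changes across some edge.\<close>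

lemma path_crosses_cut:
  assumes "distinct p" "p \<noteq> []" "(hd p \<in> S) \<noteq> (last p \<in> S)"
  shows "\<exists>e\<in>path_edges p. card (e \<inter> S) = 1"
  using assms
proof (induction p)
  case (Cons v p)
  then have "p \<noteq> []" by auto
  with Cons.prems have "v \<noteq> hd p" by auto
  show ?case
  proof (cases "(v \<in> S) \<noteq> (hd p \<in> S)")
    case True
    with \<open>p \<noteq> []\<close> \<open>v \<noteq> hd p\<close> show ?thesis
      by (intro bexI[of _ "{v, hd p}"]) (auto simp: path_edges_Cons)
  next
    case False
    with Cons \<open>p \<noteq> []\<close> show ?thesis by (auto simp: path_edges_Cons)
  qed
qed simp

section \<open>Finiteness and sign facts for networks\<close>

lemma paths_finite: "is_network G \<Longrightarrow> finite (paths G)"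
  by (rule finite_subset[OF _ finite_subset_distinct[of "verts G"]])
    (auto simp: is_network_def paths_def)

lemma edges_finite:
  assumes "is_network G"
  shows "finite (edges G)"
proof (rule finite_subset)
  show "edges G \<subseteq> Pow (verts G)" using assms by (auto simp: is_network_def)
  show "finite (Pow (verts G))" using assms by (auto simp: is_network_def)
qed

lemma edgeE:
  assumes "is_network G" "e \<in> edges G"
  obtains u v where "e = {u, v}" "u \<in> verts G" "v \<in> verts G" "u \<noteq> v"
  using assms unfolding is_network_def by blast

lemma cap_nonneg: "is_network G \<Longrightarrow> e \<in> edges G \<Longrightarrow> 0 \<le> cap G e"
  by (auto simp: is_network_def)

lemma boundary_finite: "is_network G \<Longrightarrow> finite (boundary G S)"
  by (rule finite_subset[OF _ edges_finite]) (auto simp: boundary_def)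

lemma boundary_cap_nonneg: "is_network G \<Longrightarrow> 0 \<le> (\<Sum>e\<in>boundary G S. cap G e)"
  by (intro sum_nonneg cap_nonneg) (auto simp: boundary_def)

section \<open>Separating edge sets and boundaries of vertex sets\<close>

lemma separates_boundary:
  assumes "A \<subseteq> S" "B \<inter> S = {}"
  shows "separates G (boundary G S) A B"
proof -
  have "path_edges p \<inter> boundary G S \<noteq> {}"
    if p: "p \<in> paths G" "hd p \<in> A" "last p \<in> B" for p
  proof -
    have "\<exists>e\<in>path_edges p. card (e \<inter> S) = 1"
      using p assms by (intro path_crosses_cut) (auto simp: paths_def)
    with p show ?thesis by (auto simp: boundary_def paths_def)
  qed
  then show ?thesis by (auto simp: separates_def)
qed

text \<open>The set \<open>S\<close> consists of the vertices reachable from \<open>A\<close> along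
  paths avoiding \<open>C\<close>. An edge leaving \<open>S\<close> outside \<open>C\<close> would
  make a further vertex reachable.\<close>

lemma separates_imp_boundary_subset:
  assumes G: "is_network G" and sep: "separates G C A B" and A: "A \<subseteq> verts G"
  obtains S where "S \<subseteq> verts G" "A \<subseteq> S" "S \<inter> B = {}" "boundary G S \<subseteq> C"
proof
  define S where "S = {last p | p. p \<in> paths G \<and> hd p \<in> A \<and> path_edges p \<inter> C = {}}"
  show "S \<subseteq> verts G" by (auto simp: S_def paths_def)
  show "A \<subseteq> S"
  proof
    fix a assume "a \<in> A"
    with A show "a \<in> S"
      unfolding S_def by (intro CollectI exI[of _ "[a]"]) (auto simp: paths_def)
  qed
  show "S \<inter> B = {}" using sep by (auto simp: S_def separates_def)
  have step: "v \<in> S" if u: "u \<in> S" and e: "{u, v} \<in> edges G" "{u, v} \<notin> C" "v \<in> verts G" for u v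
  proof -
    from u obtain p where p: "p \<in> paths G" "hd p \<in> A" "path_edges p \<inter> C = {}" "u = last p"
      by (auto simp: S_def)
    then have "p \<noteq> []" by (auto simp: paths_def)
    \<comment> \<open>The new vertex \<open>v\<close> may already occur on \<open>p\<close>, so the
      extended walk is shortened to a simple path.\<close>
    obtain q where q: "q \<noteq> []" "distinct q" "set q \<subseteq> set (p @ [v])" "hd q = hd (p @ [v])"
      "last q = last (p @ [v])" "path_edges q \<subseteq> path_edges (p @ [v])"
      using obtain_simple_path[of "p @ [v]"] by blast
    have "q \<in> paths G" "path_edges q \<inter> C = {}"
      using p q e \<open>p \<noteq> []\<close> by (auto simp: paths_def path_edges_snoc)
    with p q \<open>p \<noteq> []\<close> show ?thesis by (auto simp: S_def)
  qed
  show "boundary G S \<subseteq> C"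
  proof (rule ccontr)
    assume "\<not> boundary G S \<subseteq> C"
    then obtain e where e: "e \<in> edges G" "card (e \<inter> S) = 1" "e \<notin> C" by (auto simp: boundary_def)
    with G obtain u v where uv: "e = {u, v}" "u \<in> verts G" "v \<in> verts G" "u \<noteq> v"
      by (blast elim: edgeE)
    with e card_doubleton_Int_eq_1[of u v S] step[of u v] step[of v u] show False
      by (auto simp: insert_commute)
  qed
qed

lemma mincut_set_finite:
  "is_network G \<Longrightarrow> finite {(\<Sum>e\<in>C. cap G e) | C. C \<subseteq> edges G \<and> separates G C A B}"
  by (rule finite_subset[of _ "(\<lambda>C. \<Sum>e\<in>C. cap G e) ` Pow (edges G)"])
    (auto simp: edges_finite)

lemma mincut_le_boundary:
  assumes "is_network G" "A \<subseteq> S" "B \<inter> S = {}"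
  shows "mincut G A B \<le> (\<Sum>e\<in>boundary G S. cap G e)"
  unfolding mincut_def
  by (rule Min_le[OF mincut_set_finite[OF assms(1)]])
    (use separates_boundary[OF assms(2,3)] in \<open>auto simp: boundary_def\<close>)

lemma boundary_le_mincut:
  assumes G: "is_network G" and A: "A \<subseteq> verts G" "A \<inter> B = {}"
  obtains S where "S \<subseteq> verts G" "A \<subseteq> S" "S \<inter> B = {}"
    "(\<Sum>e\<in>boundary G S. cap G e) \<le> mincut G A B"
proof -
  let ?M = "{(\<Sum>e\<in>C. cap G e) | C. C \<subseteq> edges G \<and> separates G C A B}"
  \<comment> \<open>The boundary of \<open>A\<close> itself separates, so \<open>Min\<close> ranges
    over a nonempty set and is attained.\<close>
  have "boundary G A \<subseteq> edges G" "separates G (boundary G A) A B"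
    using separates_boundary[of A A B G] A by (auto simp: boundary_def)
  then have "?M \<noteq> {}" by blast
  then have "mincut G A B \<in> ?M"
    unfolding mincut_def by (rule Min_in[OF mincut_set_finite[OF G]])
  then obtain C where C: "C \<subseteq> edges G" "separates G C A B" "mincut G A B = (\<Sum>e\<in>C. cap G e)"
    by blast
  obtain S where S: "S \<subseteq> verts G" "A \<subseteq> S" "S \<inter> B = {}" "boundary G S \<subseteq> C"
    using separates_imp_boundary_subset[OF G C(2) A(1)] .
  have "(\<Sum>e\<in>boundary G S. cap G e) \<le> (\<Sum>e\<in>C. cap G e)"
    using S(4) C(1) cap_nonneg[OF G] finite_subset[OF C(1) edges_finite[OF G]]
    by (intro sum_mono2) auto
  with S C(3) that show thesis by simp
qed

text \<open>Demand pairs consist of terminals, so only the trace of a set on \<open>T\<close>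
  matters. This allows a vertex set of one network to be replaced by one of another network.\<close>

lemma separated_demand_cong:
  assumes "demand_support T F" "S \<inter> T = S' \<inter> T"
  shows "separated_demand F d S = separated_demand F d S'"
proof -
  have "f \<inter> S = f \<inter> S'" if "f \<in> F" for f
    using that assms by (fastforce simp: demand_support_def)
  then show ?thesis unfolding separated_demand_def by (metis (no_types, lifting))
qed

section \<open>Flow rate and sparsity\<close>

text \<open>The support is required on \<open>verts G\<close> and not on a fixed terminal set, so
  the facts apply alike to the original network, the cut-sparsifier and its rescaled
  version.\<close>

locale demand_network =
  fixes G :: "'v network" and F :: "'v set set"
  assumes network: "is_network G"
    and support: "demand_support (verts G) F"
begin

lemma F_finite: "finite F"
proof (rule finite_subset)
  show "F \<subseteq> Pow (verts G)" using support by (auto simp: demand_support_def)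
  show "finite (Pow (verts G))" using network by (auto simp: is_network_def)
qed

lemma supportE:
  assumes "f \<in> F"
  obtains i j where "f = {i, j}" "i \<in> verts G" "j \<in> verts G" "i \<noteq> j"
  using assms support unfolding demand_support_def by blast

lemma demand_nonneg: "d \<in> demands F \<Longrightarrow> 0 \<le> d f"
  by (cases "f \<in> F") (auto simp: demands_def)

lemma separated_demand_nonneg: "d \<in> demands F \<Longrightarrow> 0 \<le> separated_demand F d S"
  unfolding separated_demand_def by (intro sum_nonneg demand_nonneg)

lemma demand_le_separated_demand:
  assumes "d \<in> demands F" "{i, j} \<in> F" "i \<in> S" "j \<notin> S"
  shows "d {i, j} \<le> separated_demand F d S"
  unfolding separated_demand_def
proof (rule member_le_sum)
  have "i \<noteq> j" using assms by auto
  with assms show "{i, j} \<in> {f \<in> F. card (f \<inter> S) = 1}"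
    using card_doubleton_Int_eq_1[of i j S] by auto
qed (use assms demand_nonneg F_finite in auto)

lemma sparsity_set_finite:
  "finite {cut_sparsity G F S d | S. S \<subseteq> verts G \<and> separated_demand F d S \<noteq> 0}"
  by (rule finite_subset[of _ "(\<lambda>S. cut_sparsity G F S d) ` Pow (verts G)"])
    (use network in \<open>auto simp: is_network_def\<close>)

text \<open>For a pair \<open>{i, j}\<close> of positive demand the singleton \<open>{i}\<close>
  separates it, so the minimum is over a nonempty finite set.\<close>

lemma sparsity_attained:
  assumes d: "d \<in> demands F - {\<lambda>_. 0}"
  obtains S where "S \<subseteq> verts G" "0 < separated_demand F d S" "sparsity G F d = cut_sparsity G F S d"
proof -
  let ?M = "{cut_sparsity G F S d | S. S \<subseteq> verts G \<and> separated_demand F d S \<noteq> 0}"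
  from d obtain f where f: "d f \<noteq> 0" "f \<in> F" by (fastforce simp: demands_def)
  then have "0 < d f" using demand_nonneg[of d f] d by auto
  obtain i j where ij: "f = {i, j}" "i \<in> verts G" "j \<in> verts G" "i \<noteq> j"
    using supportE[OF f(2)] .
  have "d f \<le> separated_demand F d {i}"
    using demand_le_separated_demand[of d i j "{i}"] d f ij by auto
  with \<open>0 < d f\<close> ij have "?M \<noteq> {}" by fastforce
  then have "sparsity G F d \<in> ?M"
    unfolding sparsity_def by (rule Min_in[OF sparsity_set_finite])
  then obtain S where "S \<subseteq> verts G" "separated_demand F d S \<noteq> 0"
    "sparsity G F d = cut_sparsity G F S d" by blast
  with separated_demand_nonneg[of d S] d that show thesis by auto
qed

text \<open>The product form also covers sets separating no demand, which are excluded from the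
  minimum.\<close>

lemma sparsity_mult_le:
  assumes d: "d \<in> demands F" and S: "S \<subseteq> verts G"
  shows "sparsity G F d * separated_demand F d S \<le> (\<Sum>e\<in>boundary G S. cap G e)"
proof (cases "separated_demand F d S = 0")
  case True
  then show ?thesis using boundary_cap_nonneg[OF network] by simp
next
  case False
  with separated_demand_nonneg[OF d, of S] have pos: "0 < separated_demand F d S" by simp
  have "sparsity G F d \<le> cut_sparsity G F S d"
    unfolding sparsity_def using S False by (intro Min_le sparsity_set_finite) auto
  with pos show ?thesis by (simp add: cut_sparsity_def pos_le_divide_eq)
qed

lemma sparsity_nonneg:
  assumes "d \<in> demands F - {\<lambda>_. 0}"
  shows "0 \<le> sparsity G F d"
  by (rule sparsity_attained[OF assms])
    (simp add: cut_sparsity_def boundary_cap_nonneg[OF network])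

text \<open>Weak duality by double counting: each path serving a separated pair crosses the boundary
  at least once, and the total load on the boundary is at most its capacity.\<close>

lemma routes_separated_le:
  assumes x: "routes G F x d"
  shows "separated_demand F d S \<le> (\<Sum>e\<in>boundary G S. cap G e)"
proof -
  let ?P = "{p \<in> paths G. {hd p, last p} \<in> F \<and> card ({hd p, last p} \<inter> S) = 1}"
  let ?FS = "{f \<in> F. card (f \<inter> S) = 1}"
  have fin: "finite (paths G)" using paths_finite[OF network] .
  have nonneg: "0 \<le> x p" if "p \<in> paths G" for p using x that by (auto simp: routes_def)
  have crossing: "1 \<le> card {e \<in> boundary G S. e \<in> path_edges p}" if p: "p \<in> ?P" for p
  proof -
    obtain i j where "{hd p, last p} = {i, j}" "i \<noteq> j" using p by (auto elim: supportE)
    then have "hd p \<noteq> last p" by auto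
    with p have "(hd p \<in> S) \<noteq> (last p \<in> S)"
      using card_doubleton_Int_eq_1[of "hd p" "last p" S] by auto
    then obtain e where "e \<in> path_edges p" "card (e \<inter> S) = 1"
      using path_crosses_cut[of p S] p by (auto simp: paths_def)
    with p have "e \<in> {e \<in> boundary G S. e \<in> path_edges p}"
      by (auto simp: boundary_def paths_def)
    then show ?thesis
      using card_gt_0_iff[of "{e \<in> boundary G S. e \<in> path_edges p}"] boundary_finite[OF network]
      by (auto simp: Suc_le_eq)
  qed
  have "separated_demand F d S
      = (\<Sum>f\<in>?FS. \<Sum>p | p \<in> ?P \<and> {hd p, last p} = f. x p)"
    unfolding separated_demand_def
  proof (rule sum.cong[OF refl])
    fix f assume f: "f \<in> ?FS"
    then have "{p. p \<in> ?P \<and> {hd p, last p} = f} = {p. p \<in> paths G \<and> {hd p, last p} = f}" by auto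
    with f x show "d f = (\<Sum>p | p \<in> ?P \<and> {hd p, last p} = f. x p)"
      by (auto simp: routes_def)
  qed
  \<comment> \<open>The separated demand is regrouped as the total flow on the paths that serve
    it.\<close>
  also have "\<dots> = (\<Sum>p\<in>?P. x p)"
    by (rule sum.group) (use fin F_finite in auto)
  also have "\<dots> \<le> (\<Sum>p\<in>?P. \<Sum>e | e \<in> boundary G S \<and> e \<in> path_edges p. x p)"
  proof (rule sum_mono)
    fix p assume p: "p \<in> ?P"
    then have "1 * x p \<le> real (card {e \<in> boundary G S. e \<in> path_edges p}) * x p"
      using crossing[OF p] nonneg[of p] by (intro mult_right_mono) auto
    then show "x p \<le> (\<Sum>e | e \<in> boundary G S \<and> e \<in> path_edges p. x p)" by simp
  qed
  \<comment> \<open>Exchanging the sums turns crossings per path into load per boundary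
    edge.\<close>
  also have "\<dots> = (\<Sum>e\<in>boundary G S. \<Sum>p | p \<in> ?P \<and> e \<in> path_edges p. x p)"
    by (rule sum.swap_restrict) (use fin boundary_finite[OF network] in auto)
  also have "\<dots> \<le> (\<Sum>e\<in>boundary G S. cap G e)"
  proof (rule sum_mono)
    fix e assume "e \<in> boundary G S"
    then have "(\<Sum>p | p \<in> paths G \<and> {hd p, last p} \<in> F \<and> e \<in> path_edges p. x p) \<le> cap G e"
      using x by (auto simp: routes_def boundary_def)
    moreover have "(\<Sum>p | p \<in> ?P \<and> e \<in> path_edges p. x p)
        \<le> (\<Sum>p | p \<in> paths G \<and> {hd p, last p} \<in> F \<and> e \<in> path_edges p. x p)"
      by (rule sum_mono2) (use fin nonneg in auto)
    ultimately show "(\<Sum>p | p \<in> ?P \<and> e \<in> path_edges p. x p) \<le> cap G e" by simp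
  qed
  finally show ?thesis .
qed

section \<open>Bounds and homogeneity of the flow rate and the sparsity\<close>

lemma scale_demands: "d \<in> demands F \<Longrightarrow> 0 \<le> l \<Longrightarrow> (\<lambda>e. l * d e) \<in> demands F"
  by (auto simp: demands_def)

lemma separated_demand_scale: "separated_demand F (\<lambda>e. l * d e) S = l * separated_demand F d S"
  by (simp add: separated_demand_def sum_distrib_left)

lemma routable_multiplier_le_sparsity:
  assumes d: "d \<in> demands F - {\<lambda>_. 0}" and l: "(\<lambda>e. l * d e) \<in> routable G F"
  shows "l \<le> sparsity G F d"
proof -
  obtain S where S: "0 < separated_demand F d S" "sparsity G F d = cut_sparsity G F S d"
    using sparsity_attained[OF d] .
  from l have "separated_demand F (\<lambda>e. l * d e) S \<le> (\<Sum>e\<in>boundary G S. cap G e)"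
    using routes_separated_le by (auto simp: routable_def)
  with S show ?thesis
    by (simp add: cut_sparsity_def separated_demand_scale pos_le_divide_eq)
qed

text \<open>Together with admissibility of the multiplier 0, this makes the real supremum in
  \<open>flow_rate\<close> a genuine least upper bound.\<close>

lemma flow_rate_set_bdd:
  assumes "d \<in> demands F - {\<lambda>_. 0}"
  shows "bdd_above {l. 0 \<le> l \<and> (\<lambda>e. l * d e) \<in> routable G F}"
  using routable_multiplier_le_sparsity[OF assms] by (intro bdd_aboveI) auto

lemma zero_routable: "(\<lambda>_. 0) \<in> routable G F"
  unfolding routable_def demands_def routes_def
  by (auto intro!: exI[of _ "\<lambda>_. 0"] cap_nonneg[OF network])

lemma multiplier_le_flow_rate:
  assumes "d \<in> demands F - {\<lambda>_. 0}" "0 \<le> l" "(\<lambda>e. l * d e) \<in> routable G F"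
  shows "l \<le> flow_rate G F d"
  unfolding flow_rate_def using assms by (intro cSup_upper flow_rate_set_bdd) auto

lemma flow_rate_leI:
  assumes "\<And>l. 0 \<le> l \<Longrightarrow> (\<lambda>e. l * d e) \<in> routable G F \<Longrightarrow> l \<le> b"
  shows "flow_rate G F d \<le> b"
proof -
  have "0 \<in> {l. 0 \<le> l \<and> (\<lambda>e. l * d e) \<in> routable G F}" using zero_routable by simp
  then show ?thesis
    unfolding flow_rate_def using assms by (intro cSup_least) blast+
qed

lemma flow_rate_nonneg: "d \<in> demands F - {\<lambda>_. 0} \<Longrightarrow> 0 \<le> flow_rate G F d"
  using zero_routable by (intro multiplier_le_flow_rate) auto

lemma flow_rate_le_sparsity: "d \<in> demands F - {\<lambda>_. 0} \<Longrightarrow> flow_rate G F d \<le> sparsity G F d"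
  by (intro flow_rate_leI routable_multiplier_le_sparsity)

text \<open>Multipliers for \<open>d\<close> and for \<open>a * d\<close> correspond by the factor
  \<open>a\<close>. Homogeneity later carries the gap inequality from routable demands to arbitrary
  ones.\<close>

lemma flow_rate_scale:
  assumes d: "d \<in> demands F - {\<lambda>_. 0}" and a: "0 < a"
  shows "a * flow_rate G F (\<lambda>e. a * d e) = flow_rate G F d"
proof (rule antisym)
  have ad: "(\<lambda>e. a * d e) \<in> demands F - {\<lambda>_. 0}"
    using d a scale_demands[of d a] by (auto simp: fun_eq_iff)
  have "flow_rate G F (\<lambda>e. a * d e) \<le> flow_rate G F d / a"
  proof (rule flow_rate_leI)
    fix l :: real assume "0 \<le> l" "(\<lambda>e. l * (a * d e)) \<in> routable G F"
    then have "l * a \<le> flow_rate G F d"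
      using d a by (intro multiplier_le_flow_rate) (auto simp: mult.assoc)
    with a show "l \<le> flow_rate G F d / a" by (simp add: pos_le_divide_eq)
  qed
  with a show "a * flow_rate G F (\<lambda>e. a * d e) \<le> flow_rate G F d"
    by (simp add: pos_le_divide_eq mult.commute)
  show "flow_rate G F d \<le> a * flow_rate G F (\<lambda>e. a * d e)"
  proof (rule flow_rate_leI)
    fix l :: real assume "0 \<le> l" "(\<lambda>e. l * d e) \<in> routable G F"
    then have "l / a \<le> flow_rate G F (\<lambda>e. a * d e)"
      using ad a by (intro multiplier_le_flow_rate) auto
    with a show "l \<le> a * flow_rate G F (\<lambda>e. a * d e)"
      by (simp add: pos_divide_le_eq mult.commute)
  qed
qed

lemma sparsity_scale:
  assumes d: "d \<in> demands F - {\<lambda>_. 0}" and a: "0 < a"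
  shows "a * sparsity G F (\<lambda>e. a * d e) = sparsity G F d"
proof -
  have ad: "(\<lambda>e. a * d e) \<in> demands F - {\<lambda>_. 0}"
    using d a scale_demands[of d a] by (auto simp: fun_eq_iff)
  obtain S where S: "S \<subseteq> verts G" "0 < separated_demand F d S"
      "sparsity G F d = cut_sparsity G F S d"
    using sparsity_attained[OF d] .
  obtain S' where S': "S' \<subseteq> verts G" "0 < separated_demand F (\<lambda>e. a * d e) S'"
      "sparsity G F (\<lambda>e. a * d e) = cut_sparsity G F S' (\<lambda>e. a * d e)"
    using sparsity_attained[OF ad] .
  have "0 < separated_demand F d S'"
    using S'(2) a by (simp add: separated_demand_scale zero_less_mult_iff)
  \<comment> \<open>The optimal set of each demand is tested against the other demand, which gives
    the two inequalities.\<close>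
  moreover have "sparsity G F d * separated_demand F d S' \<le> (\<Sum>e\<in>boundary G S'. cap G e)"
    using d S' by (intro sparsity_mult_le) auto
  moreover have "sparsity G F (\<lambda>e. a * d e) * separated_demand F (\<lambda>e. a * d e) S
      \<le> (\<Sum>e\<in>boundary G S. cap G e)"
    using ad S by (intro sparsity_mult_le) auto
  ultimately have "sparsity G F d \<le> (\<Sum>e\<in>boundary G S'. cap G e) / separated_demand F d S'"
    "a * sparsity G F (\<lambda>e. a * d e) \<le> (\<Sum>e\<in>boundary G S. cap G e) / separated_demand F d S"
    using S(2) by (simp_all add: pos_le_divide_eq separated_demand_scale mult_ac)
  with S(3) S'(3) a show ?thesis
    by (simp add: cut_sparsity_def separated_demand_scale)
qed

section \<open>The flow-cut gap is finite\<close>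

text \<open>Let \<open>C\<close> be the edges too thin for the claimed bound. If \<open>C\<close>
  separated the pair, it would contain the boundary of some \<open>S\<close> separating it, whose
  capacity is at least \<open>sparsity G F d * d f\<close>. But the edges of \<open>C\<close>, at
  most \<open>card (edges G)\<close> many, are together strictly below that value.\<close>

lemma bottleneck_path:
  assumes d: "d \<in> demands F - {\<lambda>_. 0}" and f: "f \<in> F"
  obtains p where "p \<in> paths G" "{hd p, last p} = f"
    "\<And>e. e \<in> path_edges p \<Longrightarrow> sparsity G F d * d f \<le> card (edges G) * cap G e"
proof -
  define C where "C = {e \<in> edges G. card (edges G) * cap G e < sparsity G F d * d f}"
  have finC: "finite C" using edges_finite[OF network] by (auto simp: C_def)
  obtain i j where ij: "f = {i, j}" "i \<in> verts G" "j \<in> verts G" "i \<noteq> j"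
    using supportE[OF f] .
  have "\<not> separates G C {i} {j}"
  proof
    assume sep: "separates G C {i} {j}"
    obtain S where S: "S \<subseteq> verts G" "{i} \<subseteq> S" "S \<inter> {j} = {}" "boundary G S \<subseteq> C"
      using separates_imp_boundary_subset[OF network sep] ij by auto
    \<comment> \<open>Connectedness provides a path between \<open>i\<close> and \<open>j\<close>,
      so a separating \<open>C\<close> is nonempty and the sum over it is strictly bounded.\<close>
    obtain q where "q \<in> paths G" "hd q = i" "last q = j"
      using network ij(2,3) unfolding is_network_def by blast
    with sep have "C \<noteq> {}" by (auto simp: separates_def)
    let ?E = "real (card (edges G))" and ?s = "sparsity G F d * d f"
    have "0 \<le> ?s" using sparsity_nonneg[OF d] demand_nonneg[of d f] d by auto
    have "?s \<le> sparsity G F d * separated_demand F d S"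
      using demand_le_separated_demand[of d i j S] d f ij S sparsity_nonneg[OF d]
      by (intro mult_left_mono) auto
    also have "\<dots> \<le> (\<Sum>e\<in>boundary G S. cap G e)"
      using d S by (intro sparsity_mult_le) auto
    also have "\<dots> \<le> (\<Sum>e\<in>C. cap G e)"
      using S(4) finC cap_nonneg[OF network] by (intro sum_mono2) (auto simp: C_def)
    finally have "?E * ?s \<le> (\<Sum>e\<in>C. ?E * cap G e)"
      unfolding sum_distrib_left[symmetric] by (intro mult_left_mono) auto
    also have "\<dots> < (\<Sum>e\<in>C. ?s)"
      using finC \<open>C \<noteq> {}\<close> by (intro sum_strict_mono) (auto simp: C_def)
    also have "\<dots> = card C * ?s" by simp
    also have "\<dots> \<le> ?E * ?s"
      using \<open>0 \<le> ?s\<close> card_mono[OF edges_finite[OF network], of C]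
      by (intro mult_right_mono) (auto simp: C_def)
    finally show False by simp
  qed
  then obtain p where p: "p \<in> paths G" "hd p = i" "last p = j" "path_edges p \<inter> C = {}"
    by (auto simp: separates_def)
  show thesis
  proof (rule that[of p])
    fix e assume "e \<in> path_edges p"
    with p have "e \<in> edges G" "e \<notin> C" by (auto simp: paths_def)
    then show "sparsity G F d * d f \<le> card (edges G) * cap G e" by (auto simp: C_def)
  qed (use p ij in auto)
qed

text \<open>A fixed fraction of every demand is sent along its bottleneck path. At most
  \<open>card F\<close> paths share an edge, and each uses at most a \<open>1 / card F\<close> share
  of its capacity.\<close>

lemma sparsity_le_flow_rate:
  assumes d: "d \<in> demands F - {\<lambda>_. 0}"
  shows "sparsity G F d \<le> card (edges G) * card F * flow_rate G F d"
proof -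
  let ?s = "sparsity G F d" and ?E = "real (card (edges G))"
  have "\<forall>f\<in>F. \<exists>p. p \<in> paths G \<and> {hd p, last p} = f
      \<and> (\<forall>e\<in>path_edges p. ?s * d f \<le> ?E * cap G e)"
    using bottleneck_path[OF d] by metis
  then obtain P where P': "\<forall>f\<in>F. P f \<in> paths G \<and> {hd (P f), last (P f)} = f
      \<and> (\<forall>e\<in>path_edges (P f). ?s * d f \<le> ?E * cap G e)"
    by (rule bchoice[THEN exE])
  have P: "P f \<in> paths G" "{hd (P f), last (P f)} = f"
    "\<And>e. e \<in> path_edges (P f) \<Longrightarrow> ?s * d f \<le> ?E * cap G e" if "f \<in> F" for f
    using P' that by blast+
  from d obtain f where f: "d f \<noteq> 0" "f \<in> F" by (fastforce simp: demands_def)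
  then have cardF: "0 < card F" using F_finite by (auto simp: card_gt_0_iff)
  obtain i j where ij: "f = {i, j}" "i \<noteq> j" using supportE[OF f(2)] by metis
  \<comment> \<open>The ends of a demand pair differ, so its path has an edge. Hence
    \<open>card (edges G)\<close> is positive and may be divided by.\<close>
  have "hd (P f) \<noteq> last (P f)"
    using P(2)[OF f(2)] ij by (metis doubleton_eq_iff)
  then have "path_edges (P f) \<noteq> {}"
    using path_crosses_cut[of "P f" "{hd (P f)}"] P(1)[OF f(2)] by (auto simp: paths_def)
  then have "edges G \<noteq> {}" using P(1)[OF f(2)] by (auto simp: paths_def)
  then have cardE: "0 < card (edges G)"
    using edges_finite[OF network] by (auto simp: card_gt_0_iff)
  \<comment> \<open>One factor of the denominator comes from the bottleneck bound, the other from up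
    to \<open>card F\<close> paths sharing an edge.\<close>
  define l where "l = ?s / (?E * card F)"
  have l: "0 \<le> l" using sparsity_nonneg[OF d] by (simp add: l_def)
  define x where "x p = (if p \<in> P ` F then l * d {hd p, last p} else 0)" for p
  have xP: "x (P f) = l * d f" if "f \<in> F" for f
    using P(2)[OF that] that by (simp add: x_def)
  have finP: "finite (paths G)" using paths_finite[OF network] .
  \<comment> \<open>The ends of a path recover its demand pair, so distinct pairs get distinct
    paths.\<close>
  have inj: "inj_on P F" by (rule inj_on_inverseI[of _ "\<lambda>p. {hd p, last p}"]) (use P(2) in auto)
  have "routes G F x (\<lambda>e. l * d e)"
    unfolding routes_def
  proof (intro conjI ballI)
    fix p show "0 \<le> x p" using l demand_nonneg[of d] d by (auto simp: x_def)
  next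
    fix f assume f: "f \<in> F"
    have "(\<Sum>p | p \<in> paths G \<and> {hd p, last p} = f. x p) = (\<Sum>p\<in>{P f}. x p)"
      by (rule sum.mono_neutral_right) (use finP P f in \<open>auto simp: x_def\<close>)
    with xP[OF f] show "(\<Sum>p | p \<in> paths G \<and> {hd p, last p} = f. x p) = l * d f" by simp
  next
    fix e assume e: "e \<in> edges G"
    let ?F = "{f \<in> F. e \<in> path_edges (P f)}"
    have "(\<Sum>p | p \<in> paths G \<and> {hd p, last p} \<in> F \<and> e \<in> path_edges p. x p) = (\<Sum>p\<in>P ` ?F. x p)"
      by (rule sum.mono_neutral_right) (use finP P in \<open>auto simp: x_def\<close>)
    also have "\<dots> = (\<Sum>f\<in>?F. x (P f))"
      by (rule sum.reindex_cong[of P]) (use inj in \<open>auto intro: inj_on_subset\<close>)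
    also have "\<dots> \<le> (\<Sum>f\<in>?F. cap G e / card F)"
    proof (rule sum_mono)
      fix f assume f: "f \<in> ?F"
      then have "?s * d f \<le> ?E * cap G e" using P(3) by auto
      then have "?s * d f / ?E \<le> cap G e" using cardE by (simp add: pos_divide_le_eq mult.commute)
      then have "?s * d f / ?E / card F \<le> cap G e / card F" by (intro divide_right_mono) auto
      with f xP show "x (P f) \<le> cap G e / card F" by (simp add: l_def)
    qed
    also have "\<dots> = card ?F * (cap G e / card F)" by simp
    also have "\<dots> \<le> card F * (cap G e / card F)"
      using card_mono[OF F_finite, of ?F] cap_nonneg[OF network e]
      by (intro mult_right_mono) auto
    also have "\<dots> = cap G e" using cardF by simp
    finally show "(\<Sum>p | p \<in> paths G \<and> {hd p, last p} \<in> F \<and> e \<in> path_edges p. x p) \<le> cap G e" .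
  qed
  then have "l \<le> flow_rate G F d"
    using d l scale_demands[of d l] by (intro multiplier_le_flow_rate) (auto simp: routable_def)
  then show ?thesis using cardE cardF by (simp add: l_def pos_divide_le_eq mult.commute)
qed

text \<open>Multiplier 1 is admissible, so the ratios defining the gap have positive
  denominators.\<close>

lemma one_le_flow_rate:
  assumes "d \<in> routable G F - {\<lambda>_. 0}"
  shows "1 \<le> flow_rate G F d"
  using assms by (intro multiplier_le_flow_rate) (auto simp: routable_def)

text \<open>A real supremum is an upper bound once its set is bounded above; the crude factor
  \<open>card (edges G) * card F\<close> provides this.\<close>

lemma ratio_le_flow_cut_gap:
  assumes d: "d \<in> routable G F - {\<lambda>_. 0}"
  shows "sparsity G F d / flow_rate G F d \<le> flow_cut_gap G F"
proof -
  let ?M = "{sparsity G F d / flow_rate G F d | d. d \<in> routable G F - {\<lambda>_. 0}}"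
  have "bdd_above ?M"
  proof (rule bdd_aboveI)
    fix r assume "r \<in> ?M"
    then obtain d where d: "d \<in> routable G F - {\<lambda>_. 0}"
      and r: "r = sparsity G F d / flow_rate G F d" by blast
    with sparsity_le_flow_rate[of d] one_le_flow_rate[OF d]
    show "r \<le> card (edges G) * card F"
      by (auto simp: pos_divide_le_eq routable_def)
  qed
  then have "sparsity G F d / flow_rate G F d \<le> Sup ?M"
    using d by (intro cSup_upper) blast+
  then show ?thesis unfolding flow_cut_gap_def using d by auto
qed

lemma one_le_flow_cut_gap: "1 \<le> flow_cut_gap G F"
proof (cases "routable G F - {\<lambda>_. 0} = {}")
  case True
  then show ?thesis by (simp add: flow_cut_gap_def)
next
  case False
  then obtain d where d: "d \<in> routable G F - {\<lambda>_. 0}" by blast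
  then have "1 \<le> sparsity G F d / flow_rate G F d"
    using one_le_flow_rate[OF d] flow_rate_le_sparsity[of d]
    by (auto simp: pos_le_divide_eq routable_def)
  with ratio_le_flow_cut_gap[OF d] show ?thesis by simp
qed

text \<open>The gap speaks of routable demands only. If the flow rate is 0, the crude bound makes
  the sparsity nonpositive; otherwise a positive multiple of \<open>d\<close> is routable, and both
  sides scale alike.\<close>

lemma sparsity_le_gap_flow_rate:
  assumes d: "d \<in> demands F - {\<lambda>_. 0}"
  shows "sparsity G F d \<le> flow_cut_gap G F * flow_rate G F d"
proof (cases "flow_rate G F d = 0")
  case True
  with sparsity_le_flow_rate[OF d] show ?thesis by simp
next
  case False
  then have "\<not> flow_rate G F d \<le> 0" using flow_rate_nonneg[OF d] by simp
  \<comment> \<open>If every admissible multiplier were at most 0, so would be their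
    supremum.\<close>
  then obtain l where l: "0 \<le> l" "(\<lambda>e. l * d e) \<in> routable G F" "0 < l"
    using flow_rate_leI[of d 0] by force
  let ?d = "\<lambda>e. l * d e"
  have ld: "?d \<in> routable G F - {\<lambda>_. 0}" using l d by (auto simp: fun_eq_iff)
  have "sparsity G F ?d \<le> flow_cut_gap G F * flow_rate G F ?d"
    using ratio_le_flow_cut_gap[OF ld] one_le_flow_rate[OF ld] by (simp add: pos_divide_le_eq)
  then have "l * sparsity G F ?d \<le> l * (flow_cut_gap G F * flow_rate G F ?d)"
    using l by simp
  also have "\<dots> = flow_cut_gap G F * (l * flow_rate G F ?d)" by simp
  finally show ?thesis by (simp only: sparsity_scale[OF d l(3)] flow_rate_scale[OF d l(3)])
qed

end

section \<open>Comparing two networks\<close>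

lemma demand_networkI:
  assumes "is_network G" "T \<subseteq> verts G" "demand_support T F"
  shows "demand_network G F"
proof
  show "demand_support (verts G) F" using assms(2,3) unfolding demand_support_def by blast
qed fact

text \<open>An optimal set \<open>S'\<close> in \<open>G'\<close> induces a partition of
  \<open>T\<close>, and a minimum cut of \<open>G\<close> for that partition is bounded by the
  boundary of a set \<open>S\<close> with the same trace. Both sets separate the same demand. The
  lemma serves in both directions: with \<open>q = 1\<close>, and with \<beta> and the networks
  exchanged.\<close>

lemma sparsity_mono_mincut:
  assumes G: "is_network G" and G': "is_network G'" and T: "T \<subseteq> verts G" "T \<subseteq> verts G'"
    and F: "demand_support T F" and d: "d \<in> demands F - {\<lambda>_. 0}" and q: "0 \<le> q"
    and mc: "\<And>A B. A \<union> B = T \<Longrightarrow> A \<inter> B = {} \<Longrightarrow> A \<noteq> {} \<Longrightarrow> B \<noteq> {} \<Longrightarrow>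
      mincut G A B \<le> q * mincut G' A B"
  shows "sparsity G F d \<le> q * sparsity G' F d"
proof -
  interpret G: demand_network G F by (rule demand_networkI[OF G T(1) F])
  interpret G': demand_network G' F by (rule demand_networkI[OF G' T(2) F])
  obtain S' where S': "S' \<subseteq> verts G'" "0 < separated_demand F d S'"
      "sparsity G' F d = cut_sparsity G' F S' d"
    using G'.sparsity_attained[OF d] .
  define A where "A = S' \<inter> T"
  define B where "B = T - S'"
  \<comment> \<open>A set containing none or all of the terminals separates no demand, so both parts
    of the partition are nonempty, as the min-cut hypothesis requires.\<close>
  have "separated_demand F d {} = 0" by (simp add: separated_demand_def)
  moreover have "separated_demand F d T = 0"
  proof -
    have "card (f \<inter> T) \<noteq> 1" if "f \<in> F" for f
    proof -
      obtain i j where "f = {i, j}" "i \<in> T" "j \<in> T" "i \<noteq> j"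
        using F \<open>f \<in> F\<close> by (auto simp: demand_support_def)
      then show ?thesis by (simp add: card_doubleton_Int_eq_1)
    qed
    then have none: "{f \<in> F. card (f \<inter> T) = 1} = {}" by blast
    show ?thesis unfolding separated_demand_def none by simp
  qed
  ultimately have "S' \<inter> T \<noteq> {} \<inter> T" "S' \<inter> T \<noteq> T \<inter> T"
    using S'(2) separated_demand_cong[OF F, of S' "{}" d] separated_demand_cong[OF F, of S' T d]
    by force+
  then have AB: "A \<noteq> {}" "B \<noteq> {}" "A \<union> B = T" "A \<inter> B = {}" by (auto simp: A_def B_def)
  obtain S where S: "S \<subseteq> verts G" "A \<subseteq> S" "S \<inter> B = {}"
      "(\<Sum>e\<in>boundary G S. cap G e) \<le> mincut G A B"
    using boundary_le_mincut[OF G, of A B] AB T by auto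
  have "S \<inter> T = S' \<inter> T" using S AB by (auto simp: A_def B_def)
  then have sep: "separated_demand F d S = separated_demand F d S'"
    by (rule separated_demand_cong[OF F])
  have "sparsity G F d * separated_demand F d S \<le> (\<Sum>e\<in>boundary G S. cap G e)"
    using d S by (intro G.sparsity_mult_le) auto
  also have "\<dots> \<le> q * mincut G' A B" using S(4) mc[of A B] AB by auto
  also have "\<dots> \<le> q * (\<Sum>e\<in>boundary G' S'. cap G' e)"
    by (intro mult_left_mono mincut_le_boundary[OF G'] q) (auto simp: A_def B_def)
  finally show ?thesis
    using S' by (simp add: sep cut_sparsity_def pos_le_divide_eq)
qed

section \<open>Multiplying all capacities by a constant\<close>

lemma is_network_scale_caps: "is_network G \<Longrightarrow> 0 \<le> a \<Longrightarrow> is_network (scale_caps a G)"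
  by (simp add: is_network_def scale_caps_def paths_def)

lemma routes_scale_caps:
  assumes "routes G F x d" "0 \<le> a"
  shows "routes (scale_caps a G) F (\<lambda>p. a * x p) (\<lambda>e. a * d e)"
  using assms
  by (auto simp: routes_def scale_caps_def paths_def sum_distrib_left[symmetric]
      intro!: mult_left_mono)

lemma routable_scale_caps:
  assumes "d \<in> routable G F" "0 \<le> a"
  shows "(\<lambda>e. a * d e) \<in> routable (scale_caps a G) F"
  using assms routes_scale_caps[of G F _ d a] by (auto simp: routable_def demands_def)

lemma flow_rate_scale_caps:
  assumes a: "0 < a"
    and G: "demand_network G F" and d: "d \<in> demands F - {\<lambda>_. 0}"
  shows "flow_rate (scale_caps a G) F d = a * flow_rate G F d"
proof (rule antisym)
  interpret G: demand_network G F by fact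
  let ?H = "scale_caps a G"
  interpret H: demand_network ?H F
  proof (rule demand_networkI)
    show "is_network ?H" using a G.network by (intro is_network_scale_caps) auto
    show "verts G \<subseteq> verts ?H" by (simp add: scale_caps_def)
  qed (rule G.support)
  \<comment> \<open>Rescaling by \<open>1 / a\<close> restores \<open>G\<close>, so one transfer
    lemma gives both inequalities.\<close>
  have inv: "scale_caps (1 / a) ?H = G" using a by (simp add: scale_caps_def)
  show "flow_rate ?H F d \<le> a * flow_rate G F d"
  proof (rule H.flow_rate_leI)
    fix l :: real assume l: "0 \<le> l" "(\<lambda>e. l * d e) \<in> routable ?H F"
    have "(\<lambda>e. (l / a) * d e) \<in> routable G F"
      using routable_scale_caps[OF l(2), of "1 / a"] a by (simp add: inv)
    then have "l / a \<le> flow_rate G F d"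
      using l a by (intro G.multiplier_le_flow_rate d) auto
    with a show "l \<le> a * flow_rate G F d" by (simp add: pos_divide_le_eq mult.commute)
  qed
  have "flow_rate G F d \<le> flow_rate ?H F d / a"
  proof (rule G.flow_rate_leI)
    fix l :: real assume l: "0 \<le> l" "(\<lambda>e. l * d e) \<in> routable G F"
    have "(\<lambda>e. (a * l) * d e) \<in> routable ?H F"
      using routable_scale_caps[OF l(2), of a] a by (simp add: mult.assoc)
    then have "a * l \<le> flow_rate ?H F d"
      using l a by (intro H.multiplier_le_flow_rate d) auto
    with a show "l \<le> flow_rate ?H F d / a" by (simp add: pos_le_divide_eq mult.commute)
  qed
  with a show "a * flow_rate G F d \<le> flow_rate ?H F d"
    by (simp add: pos_le_divide_eq mult.commute)
qed

text \<open>Each path is replaced by a simple path inside its image under \<phi>. The load on a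
  merged edge is at most the sum of the loads on its preimages, and its capacity is the sum of their
  increased capacities.\<close>

lemma contraction_routable:
  assumes G: "is_network G" and G': "is_network G'"
    and F: "demand_support T F" and con: "contraction_based T G G'" and d: "d \<in> routable G F"
  shows "d \<in> routable G' F"
proof -
  from con obtain c \<phi> where c: "\<And>e. e \<in> edges G \<Longrightarrow> cap G e \<le> c e"
    and \<phi>: "\<And>t. t \<in> T \<Longrightarrow> \<phi> t = t"
    and V': "verts G' = \<phi> ` verts G"
    and E': "edges G' = {\<phi> ` e | e. e \<in> edges G \<and> card (\<phi> ` e) = 2}"
    and cap': "\<And>e'. e' \<in> edges G' \<Longrightarrow> cap G' e' = (\<Sum>e | e \<in> edges G \<and> \<phi> ` e = e'. c e)"
    unfolding contraction_based_def by (elim exE conjE) (rule that; simp)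
  from d obtain x where x: "routes G F x d" and dF: "d \<in> demands F" by (auto simp: routable_def)
  have nonneg: "0 \<le> x p" if "p \<in> paths G" for p using x that by (auto simp: routes_def)
  have finP: "finite (paths G)" "finite (paths G')" using paths_finite G G' by auto
  have finE: "finite (edges G)" using edges_finite[OF G] .
  have "\<exists>q. q \<in> paths G' \<and> hd q = \<phi> (hd p) \<and> last q = \<phi> (last p)
      \<and> path_edges q \<subseteq> (`) \<phi> ` path_edges p" if p: "p \<in> paths G" for p
  proof -
    have ne: "p \<noteq> []" using p by (auto simp: paths_def)
    \<comment> \<open>The image walk may repeat vertices, for instance where an edge collapses to a
      loop.\<close>
    then obtain q where q: "q \<noteq> []" "distinct q" "set q \<subseteq> set (map \<phi> p)" "hd q = hd (map \<phi> p)"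
      "last q = last (map \<phi> p)" "path_edges q \<subseteq> path_edges (map \<phi> p)"
      using obtain_simple_path[of "map \<phi> p"] by auto
    \<comment> \<open>Edges of a simple path have two elements, so none of them is a loop removed by
      the contraction.\<close>
    have "path_edges q \<subseteq> edges G'"
    proof
      fix e' assume e': "e' \<in> path_edges q"
      with q obtain e where "e \<in> path_edges p" "e' = \<phi> ` e" by (auto simp: path_edges_map)
      with card_path_edge[OF q(2) e'] p show "e' \<in> edges G'" by (auto simp: E' paths_def)
    qed
    moreover have "set q \<subseteq> verts G'" using q(3) p by (auto simp: V' paths_def)
    ultimately show ?thesis
      using q ne by (intro exI[of _ q]) (auto simp: paths_def path_edges_map hd_map last_map)
  qed
  then have "\<forall>p\<in>paths G. \<exists>q. q \<in> paths G' \<and> hd q = \<phi> (hd p) \<and> last q = \<phi> (last p)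
      \<and> path_edges q \<subseteq> (`) \<phi> ` path_edges p" by blast
  then obtain r where r': "\<forall>p\<in>paths G. r p \<in> paths G' \<and> hd (r p) = \<phi> (hd p)
      \<and> last (r p) = \<phi> (last p) \<and> path_edges (r p) \<subseteq> (`) \<phi> ` path_edges p"
    by (rule bchoice[THEN exE])
  have r: "r p \<in> paths G'" "hd (r p) = \<phi> (hd p)" "last (r p) = \<phi> (last p)"
    "path_edges (r p) \<subseteq> (`) \<phi> ` path_edges p" if "p \<in> paths G" for p
    using r' that by blast+
  \<comment> \<open>Only paths serving a pair of \<open>F\<close> are pushed forward. Their ends are
    terminals, which \<phi> fixes, so the commodity is preserved.\<close>
  define P where "P = {p \<in> paths G. {hd p, last p} \<in> F}"
  have finPF: "finite P" using finP by (simp add: P_def)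
  have ends: "{hd (r p), last (r p)} = {hd p, last p}" if "p \<in> P" for p
  proof -
    have "hd p \<in> T" "last p \<in> T"
      using that F by (auto simp: P_def demand_support_def doubleton_eq_iff)
    with that show ?thesis by (simp add: P_def r \<phi>)
  qed
  \<comment> \<open>Several paths may share one image, whose flow is then the sum of theirs.\<close>
  define y where "y q = (\<Sum>p | p \<in> P \<and> r p = q. x p)" for q
  have push: "(\<Sum>q\<in>Q. y q) = (\<Sum>p | p \<in> P \<and> r p \<in> Q. x p)" if Q: "Q \<subseteq> paths G'" for Q
  proof -
    have "(\<Sum>q\<in>Q. y q) = (\<Sum>q\<in>Q. \<Sum>p | p \<in> {p. p \<in> P \<and> r p \<in> Q} \<and> r p = q. x p)"
      unfolding y_def by (intro sum.cong refl) auto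
    also have "\<dots> = (\<Sum>p | p \<in> P \<and> r p \<in> Q. x p)"
      by (rule sum.group) (use finPF finite_subset[OF Q finP(2)] in auto)
    finally show ?thesis .
  qed
  have "routes G' F y d"
    unfolding routes_def
  proof (intro conjI ballI)
    fix q show "0 \<le> y q" unfolding y_def by (intro sum_nonneg nonneg) (auto simp: P_def)
  next
    fix f assume f: "f \<in> F"
    have "{p. p \<in> P \<and> r p \<in> {q. q \<in> paths G' \<and> {hd q, last q} = f}}
        = {p. p \<in> P \<and> {hd p, last p} = f}"
      using ends r(1) by (auto simp: P_def)
    also have "\<dots> = {p. p \<in> paths G \<and> {hd p, last p} = f}" using f by (auto simp: P_def)
    finally have "{p. p \<in> P \<and> r p \<in> {q. q \<in> paths G' \<and> {hd q, last q} = f}}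
        = {p. p \<in> paths G \<and> {hd p, last p} = f}" .
    with push[of "{q. q \<in> paths G' \<and> {hd q, last q} = f}"] x f
    show "(\<Sum>q | q \<in> paths G' \<and> {hd q, last q} = f. y q) = d f"
      by (auto simp: routes_def)
  next
    fix e' assume e': "e' \<in> edges G'"
    let ?Q = "{q. q \<in> paths G' \<and> {hd q, last q} \<in> F \<and> e' \<in> path_edges q}"
    let ?R = "{p. p \<in> P \<and> r p \<in> ?Q}" and ?E = "{e. e \<in> edges G \<and> \<phi> ` e = e'}"
    have "(\<Sum>q\<in>?Q. y q) = (\<Sum>p\<in>?R. x p)" by (rule push) auto
    also have "\<dots> \<le> (\<Sum>p\<in>?R. \<Sum>e | e \<in> ?E \<and> e \<in> path_edges p. x p)"
    proof (rule sum_mono)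
      fix p assume p: "p \<in> ?R"
      then have pG: "p \<in> paths G" by (simp add: P_def)
      \<comment> \<open>Some edge of \<open>p\<close> maps onto \<open>e'\<close>, so
        \<open>x p\<close> occurs at least once in the inner sum.\<close>
      with p r(4) obtain e where "e \<in> path_edges p" "e' = \<phi> ` e" by blast
      with pG have e: "e \<in> {e. e \<in> ?E \<and> e \<in> path_edges p}" by (auto simp: paths_def)
      show "x p \<le> (\<Sum>e | e \<in> ?E \<and> e \<in> path_edges p. x p)"
        by (rule member_le_sum[OF e, of "\<lambda>_. x p"]) (use finE nonneg[OF pG] in auto)
    qed
    also have "\<dots> = (\<Sum>e\<in>?E. \<Sum>p | p \<in> ?R \<and> e \<in> path_edges p. x p)"
      by (rule sum.swap_restrict) (use finPF finE in auto)
    also have "\<dots> \<le> (\<Sum>e\<in>?E. c e)"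
    proof (rule sum_mono)
      fix e assume e: "e \<in> ?E"
      have "(\<Sum>p | p \<in> ?R \<and> e \<in> path_edges p. x p)
          \<le> (\<Sum>p | p \<in> paths G \<and> {hd p, last p} \<in> F \<and> e \<in> path_edges p. x p)"
        by (rule sum_mono2) (use finP nonneg in \<open>auto simp: P_def\<close>)
      also have "\<dots> \<le> cap G e" using x e by (auto simp: routes_def)
      also have "\<dots> \<le> c e" using c e by auto
      finally show "(\<Sum>p | p \<in> ?R \<and> e \<in> path_edges p. x p) \<le> c e" .
    qed
    finally show "(\<Sum>q\<in>?Q. y q) \<le> cap G' e'" by (simp add: cap'[OF e'])
  qed
  with dF show ?thesis by (auto simp: routable_def)
qed

section \<open>The two-sided bound and the flow sparsifiers\<close>

theorem theorem7p1:
  fixes G G' :: "'v network" and T :: "'v set" and F :: "'v set set" and k :: nat and \<beta> :: real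
  assumes "terminal_network k T G"
    and "cut_sparsifier T G G' \<beta>"
    and "demand_support T F"
  shows "(\<forall>d \<in> demands F - {\<lambda>_. 0}.
            (flow_rate G F d \<noteq> 0 \<longrightarrow>
               1 / flow_cut_gap G' F \<le> flow_rate G' F d / flow_rate G F d \<and>
               flow_rate G' F d / flow_rate G F d \<le> \<beta> * flow_cut_gap G F) \<and>
            (flow_rate G F d = 0 \<longrightarrow> flow_rate G' F d = 0)) \<and>
         flow_sparsifier T F G (scale_caps (flow_cut_gap G' F) G')
           (\<beta> * flow_cut_gap G F * flow_cut_gap G' F) \<and>
         (contraction_based T G G' \<longrightarrow>
            (\<forall>d \<in> demands F - {\<lambda>_. 0}. flow_rate G F d \<le> flow_rate G' F d) \<and>
            flow_sparsifier T F G G' (\<beta> * flow_cut_gap G F))"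
proof -
  have G: "is_network G" "T \<subseteq> verts G" and G': "is_network G'" "T \<subseteq> verts G'"
    and \<beta>: "1 \<le> \<beta>"
    using assms by (auto simp: terminal_network_def cut_sparsifier_def)
  interpret G: demand_network G F by (rule demand_networkI[OF G assms(3)])
  interpret G': demand_network G' F by (rule demand_networkI[OF G' assms(3)])
  let ?g = "flow_cut_gap G F" and ?g' = "flow_cut_gap G' F"
  have g': "0 < ?g'" using G'.one_le_flow_cut_gap by simp
  \<comment> \<open>The chain is flow rate in \<open>G\<close>, sparsity in \<open>G\<close>,
    sparsity in \<open>G'\<close>, and gap times flow rate in \<open>G'\<close>.\<close>
  have lower: "flow_rate G F d \<le> ?g' * flow_rate G' F d"
    if d: "d \<in> demands F - {\<lambda>_. 0}" for d
  proof -
    have "sparsity G F d \<le> 1 * sparsity G' F d"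
      using assms(2) by (intro sparsity_mono_mincut[OF G(1) G'(1) G(2) G'(2) assms(3) d])
        (auto simp: cut_sparsifier_def)
    with G.flow_rate_le_sparsity[OF d] G'.sparsity_le_gap_flow_rate[OF d] show ?thesis by simp
  qed
  \<comment> \<open>The same chain with the networks exchanged, losing the factor \<beta> between
    the sparsities.\<close>
  have upper: "flow_rate G' F d \<le> \<beta> * ?g * flow_rate G F d"
    if d: "d \<in> demands F - {\<lambda>_. 0}" for d
  proof -
    have "flow_rate G' F d \<le> sparsity G' F d" by (rule G'.flow_rate_le_sparsity[OF d])
    also have "\<dots> \<le> \<beta> * sparsity G F d"
      using assms(2) \<beta> by (intro sparsity_mono_mincut[OF G'(1) G(1) G'(2) G(2) assms(3) d])
        (auto simp: cut_sparsifier_def)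
    also have "\<dots> \<le> \<beta> * (?g * flow_rate G F d)"
      using \<beta> G.sparsity_le_gap_flow_rate[OF d] by (intro mult_left_mono) auto
    finally show ?thesis by (simp add: mult.assoc)
  qed
  \<comment> \<open>A zero denominator is treated apart: there \<open>upper\<close> and
    nonnegativity force the flow rate in \<open>G'\<close> to vanish too.\<close>
  have ratios: "\<forall>d \<in> demands F - {\<lambda>_. 0}.
      (flow_rate G F d \<noteq> 0 \<longrightarrow>
         1 / ?g' \<le> flow_rate G' F d / flow_rate G F d \<and>
         flow_rate G' F d / flow_rate G F d \<le> \<beta> * ?g) \<and>
      (flow_rate G F d = 0 \<longrightarrow> flow_rate G' F d = 0)"
  proof (intro ballI conjI impI)
    fix d assume d: "d \<in> demands F - {\<lambda>_. 0}" and "flow_rate G F d \<noteq> 0"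
    with G.flow_rate_nonneg[OF d] have pos: "0 < flow_rate G F d" by simp
    with lower[OF d] g' show "1 / ?g' \<le> flow_rate G' F d / flow_rate G F d"
      by (simp add: field_simps)
    show "flow_rate G' F d / flow_rate G F d \<le> \<beta> * ?g"
      using pos upper[OF d] by (simp add: pos_divide_le_eq)
  next
    fix d assume d: "d \<in> demands F - {\<lambda>_. 0}" and "flow_rate G F d = 0"
    with upper[OF d] G'.flow_rate_nonneg[OF d] show "flow_rate G' F d = 0" by simp
  qed
  have scaled: "flow_sparsifier T F G (scale_caps ?g' G') (\<beta> * ?g * ?g')"
    unfolding flow_sparsifier_def
  proof (intro conjI ballI)
    show "is_network (scale_caps ?g' G')" using G' g' by (intro is_network_scale_caps) auto
    show "T \<subseteq> verts (scale_caps ?g' G')" using G' by (simp add: scale_caps_def)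
    fix d assume d: "d \<in> demands F - {\<lambda>_. 0}"
    have scale: "flow_rate (scale_caps ?g' G') F d = ?g' * flow_rate G' F d"
      by (rule flow_rate_scale_caps[OF g' G'.demand_network_axioms d])
    show "flow_rate G F d \<le> flow_rate (scale_caps ?g' G') F d"
      using lower[OF d] by (simp add: scale)
    show "flow_rate (scale_caps ?g' G') F d \<le> \<beta> * ?g * ?g' * flow_rate G F d"
      using mult_left_mono[OF upper[OF d], of ?g'] g' by (simp add: scale algebra_simps)
  qed
  \<comment> \<open>Every multiplier admissible in \<open>G\<close> is admissible in
    \<open>G'\<close>, so the lower bound holds without rescaling.\<close>
  have contr: "flow_rate G F d \<le> flow_rate G' F d"
    if "contraction_based T G G'" "d \<in> demands F - {\<lambda>_. 0}" for d
    using that contraction_routable[OF G(1) G'(1) assms(3)]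
    by (intro G.flow_rate_leI G'.multiplier_le_flow_rate) auto
  show ?thesis
    using ratios scaled contr upper G' by (auto simp: flow_sparsifier_def)
qed

end
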